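(* Let $s=\sigma+it$ with $\sigma\in(0,1]$, $s\neq 1$ and $t\ne 0$. Let $x\geq1$ with $|t|<2\pi x$. Define $R(s;x)$ by \[ \zeta(s)=\sum_{n\leq x}n^{-s} - \frac{x^{1-s}}{1-s} + R(s;x). \] Then \[ \left|R(s;x)\right| \leq x^{-\sigma}\left(\frac{1}{2}+\frac{3x}{|t|}\sqrt{1+\left(\frac{\sigma}{t}\right)^2}\left(1-\frac{t}{2x}\cot{\frac{t}{2x}}\right)\right). \]
   Context: $\zeta(s)$ is the Riemann zeta-function. *)

theory Defs
  imports "HOL-Complex_Analysis.Complex_Analysis"
begin

text \<open>
  The Riemann zeta-function, as the analytic continuation of its Dirichlet series from
  \<open>Re s > 1\<close>. It is enough to continue the series to some half-plane \<open>Re z > a\<close>, punctured at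
  the pole \<open>1\<close>, that contains \<open>s\<close>: these domains are nested and connected, so the value at
  \<open>s\<close> depends neither on \<open>a\<close> nor on \<open>f\<close> (see \<open>riemann_zeta_eqI\<close> below), and letting \<open>a\<close>
  decrease reaches every \<open>s \<noteq> 1\<close>. The value at \<open>s = 1\<close> is meaningless.
\<close>
definition riemann_zeta :: "complex \<Rightarrow> complex" where
  "riemann_zeta s = (THE w. \<exists>f a. a < Re s \<and> f holomorphic_on ({z. Re z > a} - {1}) \<and>
      (\<forall>z. Re z > 1 \<longrightarrow> f z = (\<Sum>n. of_nat (Suc n) powr (-z))) \<and> w = f s)"

lemma zeta_continuation_unique:
  fixes f g :: "complex \<Rightarrow> complex"
  assumes f: "f holomorphic_on ({z. Re z > a} - {1})"
    and g: "g holomorphic_on ({z. Re z > b} - {1})"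
    and eq: "\<And>z. Re z > 1 \<Longrightarrow> f z = g z"
    and s: "a < Re s" "b < Re s" "s \<noteq> 1"
  shows "f s = g s"
proof (cases "Re s > 1")
  case False
  define c where "c = max a b"
  have c: "c < Re s" "a \<le> c" "b \<le> c" "c < 1" using s False by (auto simp: c_def)
  let ?S = "{z. Re z > c} - {1::complex}"
  have op: "open {z. Re z > c}" by (simp add: open_halfspace_Re_gt)
  have conn: "connected ?S"
    by (rule connected_open_delete)
       (use op in \<open>auto intro: convex_connected convex_halfspace_Re_gt\<close>)
  have opS: "open ?S" using op by (simp add: open_delete)
  have holf: "f holomorphic_on ?S" by (rule holomorphic_on_subset[OF f]) (use c in auto)
  have holg: "g holomorphic_on ?S" by (rule holomorphic_on_subset[OF g]) (use c in auto)
  have op1: "open {z::complex. Re z > 1}" by (simp add: open_halfspace_Re_gt)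
  have "(2::complex) \<in> {z. Re z > 1}" by simp
  hence ne: "{z::complex. Re z > 1} \<noteq> {}" by blast
  have sub: "{z. Re z > 1} \<subseteq> ?S" using c by auto
  have sS: "s \<in> ?S" using c s by auto
  show ?thesis
    by (rule analytic_continuation_open[OF op1 opS ne conn sub holf holg])
       (use eq sS in auto)
qed (rule eq)

lemma riemann_zeta_eqI:
  assumes "f holomorphic_on ({z. Re z > a} - {1})"
    and "\<And>z. Re z > 1 \<Longrightarrow> f z = (\<Sum>n. of_nat (Suc n) powr (-z))"
    and "a < Re s" "s \<noteq> 1"
  shows "riemann_zeta s = f s"
  unfolding riemann_zeta_def
proof (rule the_equality)
  show "\<exists>f' a. a < Re s \<and> f' holomorphic_on ({z. Re z > a} - {1}) \<and>
      (\<forall>z. Re z > 1 \<longrightarrow> f' z = (\<Sum>n. of_nat (Suc n) powr (-z))) \<and> f s = f' s"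
    using assms by blast
next
  fix w
  assume "\<exists>f a. a < Re s \<and> f holomorphic_on ({z. Re z > a} - {1}) \<and>
      (\<forall>z. Re z > 1 \<longrightarrow> f z = (\<Sum>n. of_nat (Suc n) powr (-z))) \<and> w = f s"
  then obtain g b where g: "b < Re s" "g holomorphic_on ({z. Re z > b} - {1})"
      "\<forall>z. Re z > 1 \<longrightarrow> g z = (\<Sum>n. of_nat (Suc n) powr (-z))" "w = g s"
    by blast
  have "g s = f s"
  proof (rule zeta_continuation_unique[OF g(2) assms(1) _ g(1) assms(3) assms(4)])
    show "g z = f z" if "Re z > 1" for z
      using g(3) assms(2)[OF that] that by metis
  qed
  with g(4) show "w = f s" by (rule trans)
qed

definition zeta_remainder :: "complex \<Rightarrow> real \<Rightarrow> complex" where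
  "zeta_remainder s x = riemann_zeta s -
     ((\<Sum>n\<in>{n::nat. 1 \<le> n \<and> real n \<le> x}. of_nat n powr (-s)) -
      of_real x powr (1 - s) / (1 - s))"

end

theory Submission
  imports Defs
begin

text \<open>
  With \<open>\<psi>(u) = u - \<lfloor>u\<rfloor> - 1/2\<close>, Euler--Maclaurin summation gives
  \<open>R(s;x) = \<psi>(x) x\<^sup>-\<^sup>s - s \<integral>\<^sub>x\<^sup>\<infinity> \<psi>(u) u\<^sup>-\<^sup>s\<^sup>-\<^sup>1 du\<close>, and the first term is at most \<open>x\<^sup>-\<^sup>\<sigma> / 2\<close>.
  In the integral, \<open>\<psi>\<close> is replaced by its Fourier series \<open>-\<Sum>k. sin (2\<pi>ku) / (\<pi>k)\<close>. Since
  \<open>|t| < 2\<pi>x\<close>, the phases \<open>2\<pi>ku \<plusminus> t ln u\<close> have no stationary point on \<open>[x, \<infinity>)\<close>, and one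
  integration by parts bounds the \<open>k\<close>-th term by \<open>x\<^sup>-\<^sup>\<sigma> 4x / ((2\<pi>kx)\<^sup>2 - t\<^sup>2)\<close>. Summing over \<open>k\<close> with the
  partial fractions of the cotangent gives the bound, even with constant \<open>2\<close> instead of \<open>3\<close>.
  The Fourier series is summed in the sense of Abel, which makes every interchange of limit and
  integral an instance of dominated convergence.
\<close>

subsection \<open>Partial fractions of the cotangent\<close>

text \<open>Logarithmic differentiation of
  \<open>rGamma z * rGamma (1 - z) = sin (pi * z) / pi\<close>: both sides are differentiated and
  the derivatives compared. The sine stays as a factor, so nothing has to be divided out
  here.\<close>

lemma Digamma_reflection:
  fixes z :: complex
  assumes "z \<notin> \<int>"
  shows "sin (of_real pi * z) * (Digamma (1 - z) - Digamma z) = of_real pi * cos (of_real pi * z)"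
proof -
  have nz: "z \<notin> \<int>\<^sub>\<le>\<^sub>0" "1 - z \<notin> \<int>\<^sub>\<le>\<^sub>0"
    using assms by (auto elim!: nonpos_Ints_cases simp: Ints_def) (metis Ints_1 Ints_diff Ints_of_int add_diff_cancel_left' assms diff_add_cancel)
  have "((\<lambda>z. rGamma z * rGamma (1 - z)) has_field_derivative
      (rGamma z * rGamma (1 - z) * (Digamma (1 - z) - Digamma z))) (at z)"
    using nz by (auto intro!: derivative_eq_intros simp: algebra_simps)
  moreover have "(\<lambda>z::complex. rGamma z * rGamma (1 - z)) = (\<lambda>z. sin (of_real pi * z) / of_real pi)"
    by (simp add: rGamma_reflection_complex)
  moreover have "((\<lambda>z. sin (of_real pi * z) / of_real pi) has_field_derivative cos (of_real pi * z)) (at z)"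
    by (auto intro!: derivative_eq_intros)
  ultimately have "rGamma z * rGamma (1 - z) * (Digamma (1 - z) - Digamma z) = cos (of_real pi * z)"
    by (metis DERIV_unique)
  thus ?thesis
    by (simp add: rGamma_reflection_complex field_simps)
qed

text \<open>Scaling by \<open>pi\<close> moves the poles to the integers. Subtracting the series of
  \<open>Digamma\<close> at \<open>1 - z\<close> and \<open>1 + z\<close> pairs the simple fractions
  into the required terms, and the reflection formula evaluates the difference as a
  cotangent.\<close>

lemma cot_partial_fractions:
  fixes y :: real
  assumes "\<bar>y\<bar> < pi" "y \<noteq> 0"
  shows "(\<lambda>k. 2 * y\<^sup>2 / ((pi * real (Suc k))\<^sup>2 - y\<^sup>2)) sums (1 - y * cot y)"
proof -
  define x where "x = y / pi"
  define z where "z = complex_of_real x"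
  have x: "y = pi * x" "\<bar>x\<bar> < 1" "x \<noteq> 0" using assms by (auto simp: x_def)
  have "x \<notin> \<int>" using x by (auto elim!: Ints_cases)
  hence zi: "z \<notin> \<int>" by (simp add: z_def)
  hence z0: "z \<noteq> 0" "1 - z \<noteq> 0" "1 + z \<noteq> 0"
    using x by (auto simp: z_def complex_eq_iff)
  have ser: "(\<lambda>k. inverse (of_nat (Suc k)) - inverse (w + of_nat k)) sums (Digamma w + euler_mascheroni)"
    if "w \<noteq> 0" for w :: complex
    using summable_Digamma[OF that] by (simp add: Digamma_def summable_sums)
  have "(\<lambda>k. inverse (1 + z + of_nat k) - inverse (1 - z + of_nat k)) sums (Digamma (1 - z) - Digamma (1 + z))"
    using sums_diff[OF ser[OF z0(2)] ser[OF z0(3)]] by simp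
  from sums_mult[OF this, of "-z"]
  have "(\<lambda>k. - z * (inverse (1 + z + of_nat k) - inverse (1 - z + of_nat k))) sums (z * Digamma (1 + z) - z * Digamma (1 - z))"
    by (simp add: algebra_simps)
  \<comment> \<open>The recurrence \<open>Digamma (1 + z) = Digamma z + 1 / z\<close> supplies the
    summand 1 and brings the arguments into the form \<open>z\<close>, \<open>1 - z\<close> of the
    reflection formula.\<close>
  also have "z * Digamma (1 + z) - z * Digamma (1 - z) = 1 - z * (Digamma (1 - z) - Digamma z)"
    using z0 Digamma_plus1[of z] by (simp add: algebra_simps)
  also have "sin y \<noteq> 0"
    using assms by (metis abs_less_iff linorder_neqE_linordered_idom neg_0_less_iff_less
        neg_equal_0_iff_equal sin_gt_zero sin_minus order_less_irrefl)
  hence "sin (of_real pi * z) \<noteq> 0"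
    unfolding z_def x(1) by (metis of_real_eq_0_iff of_real_mult sin_of_real)
  hence "Digamma (1 - z) - Digamma z = of_real pi * cot (of_real pi * z)"
    using Digamma_reflection[OF zi] by (simp add: cot_def field_simps)
  also have "1 - z * (of_real pi * cot (of_real pi * z)) = of_real (1 - y * cot y)"
    by (simp add: z_def x(1) cot_of_real)
  also have "(\<lambda>k. - z * (inverse (1 + z + of_nat k) - inverse (1 - z + of_nat k)))
     = (\<lambda>k. of_real (2 * y\<^sup>2 / ((pi * real (Suc k))\<^sup>2 - y\<^sup>2)))"
  proof
    fix k
    have p: "1 + x + real k \<noteq> 0" "1 - x + real k \<noteq> 0" using x by linarith+
    have "- x * (inverse (1 + x + real k) - inverse (1 - x + real k)) =
      2 * x\<^sup>2 / ((1 + x + real k) * (1 - x + real k))"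
      using p by (simp add: divide_simps) (simp add: algebra_simps power2_eq_square)
    also have "\<dots> = 2 * y\<^sup>2 / (pi\<^sup>2 * ((1 + x + real k) * (1 - x + real k)))"
      by (simp add: x(1) power_mult_distrib)
    also have "pi\<^sup>2 * ((1 + x + real k) * (1 - x + real k)) = (pi * real (Suc k))\<^sup>2 - y\<^sup>2"
      by (simp add: x(1) power2_eq_square algebra_simps)
    finally have *: "- x * (inverse (1 + x + real k) - inverse (1 - x + real k)) =
      2 * y\<^sup>2 / ((pi * real (Suc k))\<^sup>2 - y\<^sup>2)" .
    show "- z * (inverse (1 + z + of_nat k) - inverse (1 - z + of_nat k)) =
       of_real (2 * y\<^sup>2 / ((pi * real (Suc k))\<^sup>2 - y\<^sup>2))"
      unfolding *[symmetric] by (simp add: z_def)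
  qed
  finally show ?thesis by (simp only: sums_of_real_iff)
qed

subsection \<open>Oscillatory integrals\<close>

text \<open>The phase has derivative \<open>c - t / u\<close>, and
  \<open>u powr (-\<sigma>-1)\<close> equals \<open>(c - t / u) * g u\<close> with
  \<open>g u = u powr (-\<sigma>) / (c * u - t)\<close>. Integration by parts thus leaves boundary
  terms of size \<open>g x\<close> and \<open>g y\<close> and an integral against \<open>g'\<close>.
  As \<open>g\<close> decreases, everything together is at most \<open>2 * g x\<close>.\<close>

lemma has_integral_oscillatory:
  fixes c t x y \<sigma> :: real
  assumes "0 < x" "x \<le> y" "0 < c" "t < c * x" "0 < \<sigma>"
  obtains I where "((\<lambda>u. exp (\<i> * of_real (c * u - t * ln u)) * of_real (u powr (-\<sigma>-1))) has_integral I) {x..y}"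
    and "norm I \<le> 2 * x powr (-\<sigma>) / (c * x - t)"
proof -
  define e where "e = (\<lambda>u::real. exp (\<i> * of_real (c * u - t * ln u)))"
  define g where "g = (\<lambda>u::real. u powr (-\<sigma>) / (c * u - t))"
  define g' where "g' = (\<lambda>u::real. -(\<sigma> * u powr (-\<sigma>-1) / (c * u - t) + c * u powr (-\<sigma>) / (c * u - t)\<^sup>2))"
  have pos: "c * u - t > 0" "u > 0" if "u \<in> {x..y}" for u
    using assms that mult_left_mono[of x u c] by (auto intro: less_le_trans)
  have dg: "(g has_vector_derivative g' u) (at u within {x..y})" if "u \<in> {x..y}" for u
    unfolding g_def g'_def has_real_derivative_iff_has_vector_derivative[symmetric]
    using pos[OF that]
    by (auto intro!: derivative_eq_intros simp: divide_simps) (auto simp: algebra_simps power2_eq_square)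
  have de: "(e has_vector_derivative (\<i> * of_real (c - t / u)) * e u) (at u within {x..y})" if "u \<in> {x..y}" for u
    unfolding e_def using pos[OF that]
    by (auto intro!: derivative_eq_intros simp: has_vector_derivative_complex_iff Re_exp Im_exp
         simp flip: has_real_derivative_iff_has_vector_derivative)
  have ig: "(g' has_integral (g y - g x)) {x..y}"
    using dg assms by (intro fundamental_theorem_of_calculus) auto
  have "((\<lambda>u. e u * of_real (g' u) + (\<i> * of_real (c - t / u)) * e u * of_real (g u)) has_integral
      (e y * of_real (g y) - e x * of_real (g x))) {x..y}"
  proof (rule fundamental_theorem_of_calculus)
    fix u assume u: "u \<in> {x..y}"
    have "((\<lambda>u. complex_of_real (g u)) has_vector_derivative of_real (g' u)) (at u within {x..y})"
      by (rule bounded_linear.has_vector_derivative[OF bounded_linear_of_real dg[OF u]])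
    from has_vector_derivative_mult[OF de[OF u] this]
    show "((\<lambda>u. e u * of_real (g u)) has_vector_derivative
       (e u * of_real (g' u) + (\<i> * of_real (c - t / u)) * e u * of_real (g u))) (at u within {x..y})" .
  qed (use assms in auto)
  hence 1: "((\<lambda>u. e u * of_real (g' u) + \<i> * (e u * of_real (u powr (-\<sigma>-1)))) has_integral
      (e y * of_real (g y) - e x * of_real (g x))) {x..y}"
  proof (rule has_integral_eq[rotated])
    fix u assume u: "u \<in> {x..y}"
    have "(c - t / u) * g u = u powr (-\<sigma>-1)"
      using pos[OF u] by (simp add: g_def field_simps powr_diff)
    thus "e u * of_real (g' u) + (\<i> * of_real (c - t / u)) * e u * of_real (g u) =
      e u * of_real (g' u) + \<i> * (e u * of_real (u powr (-\<sigma>-1)))"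
      by (metis (no_types, lifting) mult.assoc mult.commute of_real_mult)
  qed
  have ne: "norm (e u) = 1" for u by (simp add: e_def)
  have gpos: "g u \<ge> 0" "g' u \<le> 0" if "u \<in> {x..y}" for u
  proof -
    have "0 \<le> \<sigma> * u powr (-\<sigma>-1) / (c * u - t)" "0 \<le> c * u powr (-\<sigma>) / (c * u - t)\<^sup>2"
      using pos[OF that] assms by auto
    thus "g' u \<le> 0" unfolding g'_def by linarith
    show "g u \<ge> 0" using pos[OF that] by (simp add: g_def)
  qed
  have nz: "u \<noteq> 0" "c * u - t \<noteq> 0" "(c * u - t)\<^sup>2 \<noteq> 0" if "u \<in> {x..y}" for u
    using pos[OF that] by auto
  have "continuous_on {x..y} g'"
    unfolding g'_def by (intro continuous_intros ballI) (use nz in blast)+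
  moreover have "continuous_on {x..y} e"
    unfolding e_def by (intro continuous_intros ballI) (use nz in blast)+
  ultimately have "(\<lambda>u. e u * of_real (g' u)) integrable_on {x..y}"
    by (intro integrable_continuous_real continuous_intros)
  then obtain J where J: "((\<lambda>u. e u * of_real (g' u)) has_integral J) {x..y}" by blast
  \<comment> \<open>Since \<open>g'\<close> has constant sign, the integral of its absolute value is
    just the drop of \<open>g\<close>; its \<open>- g y\<close> later cancels the boundary term at
    \<open>y\<close>.\<close>
  have nJ: "norm J \<le> g x - g y"
  proof -
    have "norm J \<le> integral {x..y} (\<lambda>u. - g' u)"
      unfolding integral_unique[OF J, symmetric]
      by (rule integral_norm_bound_integral)
         (use J ig gpos ne in \<open>auto simp: norm_mult intro: integrable_neg\<close>)
    also have "\<dots> = g x - g y" using integral_unique[OF has_integral_neg[OF ig]] by simp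
    finally show ?thesis .
  qed
  define D where "D = e y * of_real (g y) - e x * of_real (g x) - J"
  have "((\<lambda>u. \<i> * (e u * of_real (u powr (-\<sigma>-1)))) has_integral D) {x..y}"
    using has_integral_diff[OF 1 J] by (simp add: D_def)
  from has_integral_mult_right[OF this, of "-\<i>"]
  have "((\<lambda>u. e u * of_real (u powr (-\<sigma>-1))) has_integral (-\<i> * D)) {x..y}"
    by (simp flip: mult.assoc)
  moreover have "norm (-\<i> * D) \<le> 2 * g x"
  proof -
    have "norm D \<le> norm (e y * of_real (g y)) + norm (e x * of_real (g x)) + norm J"
      unfolding D_def by norm
    also have "\<dots> \<le> g y + g x + (g x - g y)"
      using nJ gpos assms by (auto simp: norm_mult ne)
    finally show ?thesis by (simp add: norm_mult)
  qed
  ultimately show ?thesis using that unfolding e_def g_def by simp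
qed

text \<open>Writing the sine by exponentials gives phases \<open>c * u - t * ln u\<close> and
  \<open>-(c * u + t * ln u)\<close>. The second is the conjugate of the first with \<open>t\<close>
  negated, so the previous lemma is applied to both signs of \<open>t\<close>, and
  \<open>1 / (c * x - t) + 1 / (c * x + t)\<close> gives the bound.\<close>

lemma has_integral_sin_powr:
  fixes s :: complex and c x y :: real
  assumes "0 < x" "x \<le> y" "\<bar>Im s\<bar> < c * x" "0 < Re s"
  obtains I where "((\<lambda>u. of_real (sin (c * u)) * of_real u powr (-s-1)) has_integral I) {x..y}"
    and "norm I \<le> x powr (-Re s) * (2 * c * x / ((c * x)\<^sup>2 - (Im s)\<^sup>2))"
proof -
  define \<sigma> t where "\<sigma> = Re s" and "t = Im s"
  have c: "0 < c" using assms by (smt (verit) zero_less_mult_pos2)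
  have t: "t < c * x" "-t < c * x" "0 < \<sigma>" using assms by (auto simp: t_def \<sigma>_def)
  obtain I where I: "((\<lambda>u. exp (\<i> * of_real (c * u - t * ln u)) * of_real (u powr (-\<sigma>-1))) has_integral I) {x..y}"
    "norm I \<le> 2 * x powr (-\<sigma>) / (c * x - t)"
    using has_integral_oscillatory[OF assms(1,2) c t(1,3)] .
  obtain J where J: "((\<lambda>u. exp (\<i> * of_real (c * u - (-t) * ln u)) * of_real (u powr (-\<sigma>-1))) has_integral J) {x..y}"
    "norm J \<le> 2 * x powr (-\<sigma>) / (c * x - (-t))"
    using has_integral_oscillatory[OF assms(1,2) c t(2,3)] .
  have "((\<lambda>u. (exp (\<i> * of_real (c * u - t * ln u)) * of_real (u powr (-\<sigma>-1)) -
         cnj (exp (\<i> * of_real (c * u - (-t) * ln u)) * of_real (u powr (-\<sigma>-1)))) / (2 * \<i>)) has_integral (I - cnj J) / (2 * \<i>)) {x..y}"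
    by (intro has_integral_divide has_integral_diff I(1) iffD2[OF has_integral_cnj J(1), unfolded o_def])
  hence "((\<lambda>u. of_real (sin (c * u)) * of_real u powr (-s-1)) has_integral (I - cnj J) / (2 * \<i>)) {x..y}"
  proof (rule has_integral_eq[rotated])
    fix u assume "u \<in> {x..y}"
    hence u: "u > 0" using assms by auto
    have "of_real u powr (-s-1) = exp (-\<i> * of_real (t * ln u)) * of_real (u powr (-\<sigma>-1))"
    proof -
      have "s = of_real \<sigma> + \<i> * of_real t" by (simp add: \<sigma>_def t_def complex_eq_iff)
      hence "(-s-1) * of_real (ln u) = -\<i> * of_real (t * ln u) + of_real ((-\<sigma>-1) * ln u)"
        by (simp add: algebra_simps)
      hence "exp ((-s-1) * of_real (ln u)) = exp (-\<i> * of_real (t * ln u)) * of_real (exp ((-\<sigma>-1) * ln u))"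
        by (simp only: exp_add exp_of_real)
      thus ?thesis using u by (simp add: powr_def Ln_of_real)
    qed
    moreover have "exp (\<i> * of_real (c * u - t * ln u)) = exp (\<i> * of_real (c * u)) * exp (-\<i> * of_real (t * ln u))"
      "cnj (exp (\<i> * of_real (c * u - (-t) * ln u))) = exp (-(\<i> * of_real (c * u))) * exp (-\<i> * of_real (t * ln u))"
      by (simp_all add: exp_cnj exp_add[symmetric] algebra_simps)
    moreover have "complex_of_real (sin (c * u)) = (exp (\<i> * of_real (c * u)) - exp (-(\<i> * of_real (c * u)))) / (2 * \<i>)"
      by (simp only: sin_of_real[symmetric] sin_exp_eq)
    ultimately show "(exp (\<i> * of_real (c * u - t * ln u)) * of_real (u powr (-\<sigma>-1)) -
         cnj (exp (\<i> * of_real (c * u - (-t) * ln u)) * of_real (u powr (-\<sigma>-1)))) / (2 * \<i>) =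
         of_real (sin (c * u)) * of_real u powr (-s-1)"
      by (simp only: complex_cnj_mult complex_cnj_complex_of_real) (simp only: diff_divide_distrib ring_distribs times_divide_eq_left mult.assoc)
  qed
  moreover have "norm ((I - cnj J) / (2 * \<i>)) \<le> x powr (-\<sigma>) * (2 * c * x / ((c * x)\<^sup>2 - t\<^sup>2))"
  proof -
    have "norm ((I - cnj J) / (2 * \<i>)) \<le> (norm I + norm J) / 2"
      using norm_triangle_ineq4[of I "cnj J"] by (simp add: norm_divide norm_mult)
    also have "\<dots> \<le> x powr (-\<sigma>) / (c * x - t) + x powr (-\<sigma>) / (c * x - (-t))"
      using I(2) J(2) by (simp add: mult.commute)
    also have "\<dots> = x powr (-\<sigma>) * (2 * c * x / ((c * x - t) * (c * x + t)))"
      using t by (simp add: divide_simps) (simp add: algebra_simps)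
    also have "(c * x - t) * (c * x + t) = (c * x)\<^sup>2 - t\<^sup>2" by (simp add: algebra_simps power2_eq_square)
    finally show ?thesis .
  qed
  ultimately show ?thesis using that unfolding \<sigma>_def t_def by blast
qed

subsection \<open>The sawtooth function and its Fourier series\<close>

text \<open>The value 0 at integers is the midpoint of the jump, so that the Abel means of the
  Fourier series converge at every point without exception.\<close>

definition sawtooth :: "real \<Rightarrow> real" where
  "sawtooth u = (if u \<in> \<int> then 0 else frac u - 1 / 2)"

text \<open>With \<open>v = frac u\<close>, the number is \<open>2 * sin (pi * v)\<close> times a
  unit vector of argument \<open>pi * (v - 1 / 2)\<close>. The modulus is positive and the argument
  lies strictly between -pi/2 and pi/2, so the principal logarithm returns it unchanged and the
  branch cut is avoided.\<close>

lemma Ln_one_minus_exp: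
  assumes "u \<notin> \<int>"
  shows "Im (Ln (1 - exp (2 * of_real pi * \<i> * of_real u))) = pi * sawtooth u"
    and "1 - exp (2 * of_real pi * \<i> * of_real u) \<notin> \<real>\<^sub>\<le>\<^sub>0"
proof -
  define v where "v = frac u"
  have v: "0 < v" "v < 1" using assms by (auto simp: v_def frac_lt_1 frac_gt_0_iff)
  have uv: "of_real u = of_int \<lfloor>u\<rfloor> + complex_of_real v" by (simp add: v_def frac_def)
  have "exp (2 * of_real pi * \<i> * of_real u) = exp (2 * of_real pi * \<i> * of_real v)"
    unfolding uv exp_eq by (intro exI[of _ "\<lfloor>u\<rfloor>"]) (simp add: algebra_simps)
  also have "1 - \<dots> = of_real (2 * sin (pi * v)) * exp (\<i> * of_real (pi * (v - 1 / 2)))"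
  proof -
    have "1 - cos (2 * (pi * v)) = 2 * sin (pi * v) * sin (pi * v)"
      by (simp add: cos_double_sin power2_eq_square)
    moreover have "sin (2 * (pi * v)) = 2 * sin (pi * v) * cos (pi * v)" by (simp add: sin_double)
    moreover have "cos (pi * v - pi / 2) = sin (pi * v)" "sin (pi * v - pi / 2) = - cos (pi * v)"
      by (simp_all add: cos_diff sin_diff)
    ultimately show ?thesis
      by (simp add: complex_eq_iff Re_exp Im_exp algebra_simps)
  qed
  finally have eq: "1 - exp (2 * of_real pi * \<i> * of_real u) = of_real (2 * sin (pi * v)) * exp (\<i> * of_real (pi * (v - 1 / 2)))" .
  have sp: "sin (pi * v) > 0" using v by (intro sin_gt_zero) auto
  have im: "\<bar>pi * (v - 1/2)\<bar> < pi / 2" using v by (auto simp: abs_if algebra_simps)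
  have "Ln (of_real (2 * sin (pi * v)) * exp (\<i> * of_real (pi * (v - 1 / 2)))) =
      Ln (of_real (2 * sin (pi * v))) + Ln (exp (\<i> * of_real (pi * (v - 1 / 2))))"
    by (intro Ln_times_of_real) (use sp in auto)
  also have "Ln (of_real (2 * sin (pi * v))) = of_real (ln (2 * sin (pi * v)))"
    by (rule Ln_of_real) (use sp in simp)
  also have "Ln (exp (\<i> * of_real (pi * (v - 1 / 2)))) = \<i> * of_real (pi * (v - 1 / 2))"
  proof -
    have "- pi < pi * (v - 1 / 2)" "pi * (v - 1 / 2) \<le> pi"
      using im pi_gt_zero unfolding abs_less_iff by linarith+
    thus ?thesis by (intro Ln_exp) simp_all
  qed
  finally have "Im (Ln (of_real (2 * sin (pi * v)) * exp (\<i> * of_real (pi * (v - 1 / 2))))) = pi * (v - 1 / 2)"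
    by simp
  thus "Im (Ln (1 - exp (2 * of_real pi * \<i> * of_real u))) = pi * sawtooth u"
    unfolding eq using assms by (simp add: sawtooth_def v_def)
  have "Re (1 - exp (2 * of_real pi * \<i> * of_real u)) > 0"
  proof -
    have "cos (pi * (v - 1 / 2)) > 0"
      using im unfolding abs_less_iff by (intro cos_gt_zero_pi) linarith+
    thus ?thesis unfolding eq using sp by (simp add: Re_exp)
  qed
  thus "1 - exp (2 * of_real pi * \<i> * of_real u) \<notin> \<real>\<^sub>\<le>\<^sub>0"
    by (auto simp: complex_nonpos_Reals_iff)
qed

text \<open>
  The Abel means of the Fourier series of \<open>sawtooth\<close>. They are bounded by \<open>1/2\<close> because
  \<open>1 - r e\<^sup>2\<^sup>\<pi>\<^sup>i\<^sup>u\<close> lies in the right half-plane.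
\<close>
definition abel_sawtooth :: "real \<Rightarrow> real \<Rightarrow> real" where
  "abel_sawtooth r u = Im (Ln (1 - of_real r * exp (2 * of_real pi * \<i> * of_real u))) / pi"

lemma Re_one_minus_pos:
  assumes "0 \<le> r" "r < 1"
  shows "Re (1 - of_real r * exp (2 * of_real pi * \<i> * of_real u)) > 0"
proof -
  have "Re (of_real r * exp (2 * of_real pi * \<i> * of_real u)) \<le> norm (of_real r * exp (2 * of_real pi * \<i> * of_real u))"
    by (rule complex_Re_le_cmod)
  also have "\<dots> = r" using assms by (simp add: norm_mult)
  finally show ?thesis using assms by simp
qed

lemma abel_sawtooth_bound:
  assumes "0 \<le> r" "r < 1"
  shows "\<bar>abel_sawtooth r u\<bar> \<le> 1 / 2"
  using Re_Ln_pos_lt_imp[OF Re_one_minus_pos[OF assms, of u]]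
  by (simp add: abel_sawtooth_def field_simps)

lemma continuous_on_abel_sawtooth:
  assumes "0 \<le> r" "r < 1"
  shows "continuous_on A (abel_sawtooth r)"
proof -
  have "1 - of_real r * exp (2 * of_real pi * \<i> * of_real u) \<notin> \<real>\<^sub>\<le>\<^sub>0" for u
    using Re_one_minus_pos[OF assms, of u] by (auto simp: complex_nonpos_Reals_iff)
  thus ?thesis unfolding abel_sawtooth_def by (intro continuous_intros) auto
qed

lemma abel_sawtooth_sums:
  assumes "0 \<le> r" "r < 1"
  shows "(\<lambda>k. - (r ^ Suc k / (pi * real (Suc k))) * sin (2 * pi * real (Suc k) * u)) sums abel_sawtooth r u"
proof -
  define w where "w = of_real r * exp (2 * of_real pi * \<i> * of_real u)"
  have "norm (-w) < 1" using assms by (simp add: w_def norm_mult)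
  from Ln_series'[OF this] have "(\<lambda>n. - (w ^ n) / of_nat n) sums Ln (1 - w)" by simp
  hence "(\<lambda>n. - (w ^ Suc n) / of_nat (Suc n)) sums Ln (1 - w)"
    by (subst sums_Suc_iff) simp
  hence "(\<lambda>n. Im (- (w ^ Suc n) / of_nat (Suc n))) sums Im (Ln (1 - w))"
    by (rule sums_Im)
  hence "(\<lambda>n. Im (- (w ^ Suc n) / of_nat (Suc n)) / pi) sums abel_sawtooth r u"
    unfolding abel_sawtooth_def w_def by (rule sums_divide)
  also have "(\<lambda>n. Im (- (w ^ Suc n) / of_nat (Suc n)) / pi) =
    (\<lambda>k. - (r ^ Suc k / (pi * real (Suc k))) * sin (2 * pi * real (Suc k) * u))"
  proof
    fix n
    have "w ^ Suc n = of_real (r ^ Suc n) * exp (of_nat (Suc n) * (2 * of_real pi * \<i> * of_real u))"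
      by (simp only: w_def power_mult_distrib exp_of_nat_mult of_real_power)
    also have "of_nat (Suc n) * (2 * of_real pi * \<i> * of_real u) = \<i> * of_real (2 * pi * real (Suc n) * u)"
      by simp
    finally have "Im (w ^ Suc n) = r ^ Suc n * sin (2 * pi * real (Suc n) * u)"
      by (simp only: Im_exp) (simp add: Im_exp)
    thus "Im (- (w ^ Suc n) / of_nat (Suc n)) / pi = - (r ^ Suc n / (pi * real (Suc n))) * sin (2 * pi * real (Suc n) * u)"
      by (simp only: Im_divide_of_nat uminus_complex.sel) (simp add: field_simps del: of_nat_Suc power_Suc)
  qed
  finally show ?thesis .
qed

text \<open>At an integer each mean is the imaginary part of the logarithm of a positive real, hence
  0. Elsewhere the limit point is off the branch cut and \<open>Ln\<close> is continuous
  there.\<close>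

lemma abel_sawtooth_tendsto:
  assumes "\<And>j. 0 \<le> r j" "\<And>j. r j < 1" "r \<longlonglongrightarrow> 1"
  shows "(\<lambda>j. abel_sawtooth (r j) u) \<longlonglongrightarrow> sawtooth u"
proof (cases "u \<in> \<int>")
  case True
  then obtain m where m: "u = of_int m" by (auto elim: Ints_cases)
  have "exp (2 * of_real pi * \<i> * of_real u) = 1"
    unfolding m exp_eq_1 by auto
  moreover have "Im (Ln (1 - of_real (r j))) = 0" for j
    using assms(2)[of j] by (metis Im_complex_of_real Ln_of_real diff_gt_0_iff_gt of_real_1 of_real_diff)
  ultimately show ?thesis using True by (simp add: abel_sawtooth_def sawtooth_def)
next
  case False
  have "(\<lambda>j. Im (Ln (1 - of_real (r j) * exp (2 * of_real pi * \<i> * of_real u))) / pi) \<longlonglongrightarrow>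
     Im (Ln (1 - of_real 1 * exp (2 * of_real pi * \<i> * of_real u))) / pi"
    using Ln_one_minus_exp(2)[OF False] by (intro tendsto_intros assms(3)) auto
  thus ?thesis using Ln_one_minus_exp(1)[OF False] by (simp add: abel_sawtooth_def)
qed

subsection \<open>The zeta function in the right half-plane\<close>

lemma has_vector_derivative_of_real_powr:
  assumes "u > 0"
  shows "((\<lambda>u. of_real u powr z :: complex) has_vector_derivative z * of_real u powr (z - 1)) (at u within A)"
proof -
  have "((\<lambda>w. w powr z) has_field_derivative z * of_real u powr (z - 1)) (at (of_real u :: complex))"
    using assms by (intro has_field_derivative_powr) (auto simp: complex_nonpos_Reals_iff)
  thus ?thesis by (rule has_vector_derivative_real_field)
qed

text \<open>
  \<open>n\<^sup>-\<^sup>z\<close> minus its mean over \<open>[n, n + 1]\<close>, with \<open>n\<close> shifted to start at \<open>1\<close>: the series of these terms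
  converges already for \<open>Re z > 0\<close>.
\<close>
definition zeta_term :: "nat \<Rightarrow> complex \<Rightarrow> complex" where
  "zeta_term n z = of_nat (Suc n) powr (-z) -
     (of_nat (Suc (Suc n)) powr (1 - z) - of_nat (Suc n) powr (1 - z)) / (1 - z)"

text \<open>The mean value inequality is used twice on the unit interval starting at
  \<open>N = n + 1\<close>: first for \<open>u powr (-z)\<close>, to bound its deviation from the
  value at \<open>N\<close>, then for an antiderivative of this deviation. The exponent below -1
  makes the terms summable.\<close>

lemma norm_zeta_term_le:
  assumes "Re z > 0" "z \<noteq> 1"
  shows "norm (zeta_term n z) \<le> norm z * real (Suc n) powr (- Re z - 1)"
proof -
  define N where "N = real (Suc n)"
  define S where "S = {N..N + 1}"
  have pos: "u > 0" "u \<ge> N" if "u \<in> S" for u using that by (auto simp: S_def N_def)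
  have N: "N > 0" "N \<in> S" "N + 1 \<in> S" by (auto simp: N_def S_def)
  have diff1: "norm (of_real u powr (-z) - of_real N powr (-z)) \<le> norm z * N powr (- Re z - 1)"
    if u: "u \<in> S" for u
  proof -
    have "norm (of_real u powr (-z) - of_real N powr (-z)) \<le> norm z * N powr (- Re z - 1) * norm (u - N)"
    proof (rule differentiable_bound[where S = S and f' = "\<lambda>v h. h *\<^sub>R (-z * of_real v powr (-z - 1))"])
      fix v assume v: "v \<in> S"
      show "((\<lambda>u. of_real u powr (-z)) has_derivative (\<lambda>h. h *\<^sub>R (-z * of_real v powr (-z - 1)))) (at v within S)"
        using has_vector_derivative_of_real_powr[OF pos(1)[OF v], of "-z" S] by (simp add: has_vector_derivative_def)
      have "v powr (- Re z - 1) \<le> N powr (- Re z - 1)"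
        using pos[OF v] N assms by (intro powr_mono2') auto
      thus "onorm (\<lambda>h. h *\<^sub>R (-z * of_real v powr (-z - 1))) \<le> norm z * N powr (- Re z - 1)"
        using pos[OF v] by (intro onorm_le) (auto simp: norm_mult norm_powr_real_powr mult_left_mono mult.commute)
    qed (use u N in \<open>auto simp: S_def\<close>)
    also have "\<dots> \<le> norm z * N powr (- Re z - 1)"
      using u by (intro mult_left_le) (auto simp: S_def)
    finally show ?thesis .
  qed
  \<comment> \<open>An antiderivative of \<open>of_real u powr (-z) - of_real N powr (-z)\<close>;
    its increment over the interval is minus \<open>zeta_term n z\<close>.\<close>
  define G where "G = (\<lambda>u::real. of_real u powr (1 - z) / (1 - z) - of_real u * of_real N powr (-z))"
  have dG: "(G has_vector_derivative (of_real u powr (-z) - of_real N powr (-z))) (at u within S)" if u: "u \<in> S" for u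
  proof -
    have "((\<lambda>u. of_real u powr (1 - z) / (1 - z)) has_vector_derivative of_real u powr (-z)) (at u within S)"
      using has_vector_derivative_divide[OF has_vector_derivative_of_real_powr[OF pos(1)[OF u], of "1 - z" S], of "1 - z"] assms(2)
      by simp
    moreover have "(complex_of_real has_vector_derivative 1) (at u within S)"
      by (auto intro!: derivative_eq_intros)
    note has_vector_derivative_mult_left[OF this, of "of_real N powr (-z)"]
    ultimately have "(G has_vector_derivative (of_real u powr (-z) - 1 * of_real N powr (-z))) (at u within S)"
      unfolding G_def by (rule has_vector_derivative_diff)
    thus ?thesis by simp
  qed
  have "norm (G (N + 1) - G N) \<le> norm z * N powr (- Re z - 1) * norm ((N + 1) - N)"
  proof (rule differentiable_bound[where S = S and f' = "\<lambda>v h. h *\<^sub>R (of_real v powr (-z) - of_real N powr (-z))"])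
    fix v assume v: "v \<in> S"
    show "(G has_derivative (\<lambda>h. h *\<^sub>R (of_real v powr (-z) - of_real N powr (-z)))) (at v within S)"
      using dG[OF v] by (simp add: has_vector_derivative_def)
    show "onorm (\<lambda>h. h *\<^sub>R (of_real v powr (-z) - of_real N powr (-z) :: complex)) \<le> norm z * N powr (- Re z - 1)"
      using diff1[OF v] by (intro onorm_le) (auto simp: mult_left_mono mult.commute)
  qed (use N in \<open>auto simp: S_def\<close>)
  moreover have "zeta_term n z = - (G (N + 1) - G N)"
    by (simp add: zeta_term_def G_def N_def diff_divide_distrib algebra_simps)
  ultimately show ?thesis by (simp add: N_def norm_minus_commute)
qed

lemma sum_zeta_term:
  assumes "z \<noteq> 1"
  shows "(\<Sum>n<M. zeta_term n z) =
    (\<Sum>n<M. of_nat (Suc n) powr (-z)) - of_nat (Suc M) powr (1 - z) / (1 - z) + 1 / (1 - z)"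
  using assms by (induction M) (auto simp: zeta_term_def diff_divide_distrib)

lemma zeta_term_holomorphic:
  "zeta_term n holomorphic_on (- {1})"
  unfolding zeta_term_def by (intro holomorphic_intros) auto

lemma of_nat_powr_tendsto_0:
  assumes "Re z < 0"
  shows "(\<lambda>n. of_nat (Suc n) powr z) \<longlonglongrightarrow> 0"
proof (rule tendsto_norm_zero_cancel)
  have "filterlim (\<lambda>n. real (Suc n)) at_top sequentially"
    by (intro filterlim_compose[OF filterlim_real_sequentially filterlim_Suc])
  hence "(\<lambda>n. real (Suc n) powr Re z) \<longlonglongrightarrow> 0"
    using assms by (intro tendsto_neg_powr)
  thus "(\<lambda>n. norm (of_nat (Suc n) powr z)) \<longlonglongrightarrow> 0"
    by (subst norm_powr_real_powr) auto
qed

text \<open>The series converges locally uniformly on the punctured half-plane, so its sum plus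
  \<open>1 / (z - 1)\<close> is holomorphic there. It agrees with the Dirichlet series for
  \<open>Re z > 1\<close>, so \<open>riemann_zeta_eqI\<close> with \<open>a = 0\<close> identifies
  it as zeta.\<close>

lemma riemann_zeta_sums:
  assumes "Re s > 0" "s \<noteq> 1"
  shows "(\<lambda>n. zeta_term n s) sums (riemann_zeta s - 1 / (s - 1))"
proof -
  define f where "f = (\<lambda>z. \<Sum>n. zeta_term n z)"
  have sm: "summable (\<lambda>n. real (Suc n) powr (- a - 1))" if "a > 0" for a
    using that by (subst summable_Suc_iff) (simp add: summable_real_powr_iff)
  have sum: "(\<lambda>n. zeta_term n z) sums f z" if "Re z > 0" "z \<noteq> 1" for z
    unfolding f_def
    by (intro summable_sums summable_comparison_test'[OF summable_mult[OF sm[OF that(1)], of "norm z"]])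
       (rule norm_zeta_term_le[OF that])
  have "f holomorphic_on ({z. Re z > 0} - {1})"
  proof (rule holomorphic_uniform_sequence[where f = "\<lambda>n z. \<Sum>k<n. zeta_term k z"])
    show op: "open ({z. Re z > 0} - {1::complex})"
      by (intro open_delete open_halfspace_Re_gt)
    show "(\<lambda>z. \<Sum>k<n. zeta_term k z) holomorphic_on {z. Re z > 0} - {1}" for n
      by (intro holomorphic_intros holomorphic_on_subset[OF zeta_term_holomorphic]) auto
    fix w :: complex assume w: "w \<in> {z. Re z > 0} - {1}"
    from op w obtain d0 where d0: "d0 > 0" "cball w d0 \<subseteq> {z. Re z > 0} - {1}"
      by (meson open_contains_cball)
    \<comment> \<open>Capping the radius at \<open>Re w / 2\<close> keeps real parts in the disc at
      least \<open>Re w / 2\<close>, so a single summable majorant serves the whole disc.\<close>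
    define d where "d = min d0 (Re w / 2)"
    have d: "d > 0" "cball w d \<subseteq> {z. Re z > 0} - {1}" "d \<le> Re w / 2"
      using d0 w by (auto simp: d_def)
    have "uniform_limit (cball w d) (\<lambda>n z. \<Sum>k<n. zeta_term k z) f sequentially"
      unfolding f_def
    proof (rule Weierstrass_m_test)
      show "summable (\<lambda>n. (norm w + d) * real (Suc n) powr (- (Re w / 2) - 1))"
        using w by (intro summable_mult sm) auto
      fix n z assume z: "z \<in> cball w d"
      have "\<bar>Re (w - z)\<bar> \<le> d" using z abs_Re_le_cmod[of "w - z"] by (simp add: dist_norm)
      hence re: "Re z \<ge> Re w / 2" using d(3) by auto
      have nz: "norm z \<le> norm w + d" using z norm_triangle_ineq2[of z w] by (simp add: dist_norm norm_minus_commute)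
      have "norm (zeta_term n z) \<le> norm z * real (Suc n) powr (- Re z - 1)"
        using z d(2) by (intro norm_zeta_term_le) auto
      also have "\<dots> \<le> (norm w + d) * real (Suc n) powr (- (Re w / 2) - 1)"
        using nz re d by (intro mult_mono powr_mono) auto
      finally show "norm (zeta_term n z) \<le> (norm w + d) * real (Suc n) powr (- (Re w / 2) - 1)" .
    qed
    thus "\<exists>d>0. cball w d \<subseteq> {z. Re z > 0} - {1} \<and>
        uniform_limit (cball w d) (\<lambda>n z. \<Sum>k<n. zeta_term k z) f sequentially"
      using d by blast
  qed
  hence "(\<lambda>z. f z + 1 / (z - 1)) holomorphic_on ({z. Re z > 0} - {1})"
    by (intro holomorphic_intros) auto
  moreover have "f z + 1 / (z - 1) = (\<Sum>n. of_nat (Suc n) powr (-z))" if z: "Re z > 1" for z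
  proof -
    have z1: "z \<noteq> 1" "Re z > 0" using z by auto
    \<comment> \<open>For \<open>Re z > 1\<close> the telescoped term
      \<open>of_nat (Suc M) powr (1 - z)\<close> tends to 0, which leaves the plain partial sums of
      the Dirichlet series.\<close>
    have "(\<lambda>M. (\<Sum>n<M. zeta_term n z) + of_nat (Suc M) powr (1 - z) / (1 - z) - 1 / (1 - z)) \<longlonglongrightarrow> f z + 0 / (1 - z) - 1 / (1 - z)"
      using sum[OF z1(2,1)] z z1 unfolding sums_def
      by (intro tendsto_intros of_nat_powr_tendsto_0) auto
    hence "(\<lambda>n. of_nat (Suc n) powr (-z)) sums (f z - 1 / (1 - z))"
      unfolding sums_def sum_zeta_term[OF z1(1)] by simp
    moreover have "f z - 1 / (1 - z) = f z + 1 / (z - 1)"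
      using z1 by (simp add: field_simps)
    ultimately show ?thesis by (simp add: sums_iff)
  qed
  ultimately have "riemann_zeta s = f s + 1 / (s - 1)"
    by (rule riemann_zeta_eqI[where a = 0]) (use assms in auto)
  thus ?thesis using sum[OF assms] by simp
qed

text \<open>For \<open>Re s \<le> 1\<close> the power of \<open>Suc M\<close> does not vanish in the
  limit and must be subtracted first. The base is \<open>Suc M\<close> because the mean in the last
  term reaches up to \<open>M + 1\<close>.\<close>

lemma riemann_zeta_LIMSEQ:
  assumes "Re s > 0" "s \<noteq> 1"
  shows "(\<lambda>M. (\<Sum>n\<in>{1..M}. of_nat n powr (-s)) - of_nat (Suc M) powr (1 - s) / (1 - s)) \<longlonglongrightarrow> riemann_zeta s"
proof -
  have "(\<lambda>M. (\<Sum>n<M. zeta_term n s) - 1 / (1 - s)) \<longlonglongrightarrow> riemann_zeta s - 1 / (s - 1) - 1 / (1 - s)"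
    using riemann_zeta_sums[OF assms] unfolding sums_def by (intro tendsto_intros)
  also have "1 / (s - 1) = - (1 / (1 - s))" by (subst minus_divide_right) simp
  also have "riemann_zeta s - - (1 / (1 - s)) - 1 / (1 - s) = riemann_zeta s" by simp
  also have "(\<lambda>M. (\<Sum>n<M. zeta_term n s) - 1 / (1 - s)) =
      (\<lambda>M. (\<Sum>n\<in>{1..M}. of_nat n powr (-s)) - of_nat (Suc M) powr (1 - s) / (1 - s))"
    unfolding sum_zeta_term[OF assms(2)] by (simp add: sum.atLeast1_atMost_eq)
  finally show ?thesis .
qed

subsection \<open>The remainder integral\<close>

text \<open>Inside the interval the sawtooth is the linear function \<open>u - N - 1 / 2\<close>,
  and integration by parts gives the explicit antiderivative \<open>F\<close>.\<close>

lemma has_integral_sawtooth_powr_step: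
  fixes s :: complex and x :: real
  assumes "s \<noteq> 1" "0 < x" "real N \<le> x" "x \<le> real N + 1"
  shows "((\<lambda>u. s * (of_real (sawtooth u) * of_real u powr (-s-1))) has_integral
     of_real (x - real N - 1 / 2) * of_real x powr (-s) - of_nat (Suc N) powr (-s) / 2 +
     (of_nat (Suc N) powr (1 - s) - of_real x powr (1 - s)) / (1 - s)) {x..real N + 1}"
proof -
  define F where "F = (\<lambda>u::real. of_real u powr (1 - s) / (1 - s) - of_real (u - real N - 1 / 2) * of_real u powr (-s))"
  have "((\<lambda>u. s * (of_real (u - real N - 1 / 2) * of_real u powr (-s-1))) has_integral F (real N + 1) - F x) {x..real N + 1}"
  proof (rule fundamental_theorem_of_calculus)
    fix u assume "u \<in> {x..real N + 1}"
    hence u: "u > 0" using assms by auto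
    have "((\<lambda>u. of_real u powr (1 - s) / (1 - s)) has_vector_derivative of_real u powr (-s)) (at u within {x..real N + 1})"
      using has_vector_derivative_divide[OF has_vector_derivative_of_real_powr[OF u, of "1 - s" "{x..real N + 1}"], of "1 - s"] assms(1)
      by simp
    moreover have "((\<lambda>u. complex_of_real (u - real N - 1 / 2)) has_vector_derivative 1) (at u within {x..real N + 1})"
      by (auto intro!: derivative_eq_intros)
    ultimately have "(F has_vector_derivative (of_real u powr (-s) - (of_real (u - real N - 1 / 2) * (-s * of_real u powr (-s - 1)) + 1 * of_real u powr (-s)))) (at u within {x..real N + 1})"
      unfolding F_def by (intro has_vector_derivative_diff has_vector_derivative_mult has_vector_derivative_of_real_powr u)
    thus "(F has_vector_derivative s * (of_real (u - real N - 1 / 2) * of_real u powr (-s-1))) (at u within {x..real N + 1})"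
      by (simp add: algebra_simps)
  qed (use assms in auto)
  also have "F (real N + 1) - F x = of_real (x - real N - 1 / 2) * of_real x powr (-s) - of_nat (Suc N) powr (-s) / 2 +
     (of_nat (Suc N) powr (1 - s) - of_real x powr (1 - s)) / (1 - s)"
    by (simp add: F_def add.commute diff_divide_distrib)
  \<comment> \<open>The sawtooth may differ from the linear function only at the integer endpoints,
    which the integral ignores.\<close>
  finally show ?thesis
  proof (rule has_integral_spike_finite[where S = "{real N, real N + 1}", rotated 2])
    fix u assume "u \<in> {x..real N + 1} - {real N, real N + 1}"
    hence u: "real N < u" "u < real N + 1" using assms by auto
    hence "frac u = u - real N" by (subst frac_unique_iff) auto
    moreover from this u have "u \<notin> \<int>" using frac_eq_0_iff[of u] by auto
    ultimately show "s * (of_real (sawtooth u) * of_real u powr (-s-1)) = s * (of_real (u - real N - 1 / 2) * of_real u powr (-s-1))"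
      by (simp add: sawtooth_def)
  qed auto
qed

text \<open>Induction over unit intervals, after the initial piece from \<open>x\<close> to the next
  integer above its floor. At each junction the half term left over cancels the half term at the
  left end of the new interval.\<close>

lemma has_integral_sawtooth_powr:
  fixes s :: complex and x :: real
  assumes "s \<noteq> 1" "1 \<le> x" "nat \<lfloor>x\<rfloor> \<le> M"
  shows "((\<lambda>u. s * (of_real (sawtooth u) * of_real u powr (-s-1))) has_integral
     of_real (frac x - 1 / 2) * of_real x powr (-s)
     - (\<Sum>n\<in>{nat \<lfloor>x\<rfloor><..Suc M}. of_nat n powr (-s)) + of_nat (Suc M) powr (-s) / 2 +
     (of_nat (Suc M) powr (1 - s) - of_real x powr (1 - s)) / (1 - s)) {x..real (Suc M)}"
  using assms(3)
proof (induction M rule: dec_induct)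
  case base
  define N where "N = nat \<lfloor>x\<rfloor>"
  have N: "real N = of_int \<lfloor>x\<rfloor>" using assms(2) by (simp add: N_def)
  have "real N \<le> x" "x \<le> real N + 1" unfolding N by linarith+
  moreover have "{N<..Suc N} = {Suc N}" by auto
  ultimately show ?case
    using has_integral_sawtooth_powr_step[OF assms(1), of x N] assms(2)
    unfolding N_def[symmetric] by (simp add: frac_def N[symmetric] add.commute)
next
  case (step M)
  have s: "s \<noteq> 1" by (fact assms(1))
  have xM: "x \<le> real (Suc M)" using step(1) by linarith
  have set: "{nat \<lfloor>x\<rfloor><..Suc (Suc M)} = insert (Suc (Suc M)) {nat \<lfloor>x\<rfloor><..Suc M}"
    using step(1) by auto
  have "((\<lambda>u. s * (of_real (sawtooth u) * of_real u powr (-s-1))) has_integral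
     of_real (real (Suc M) - real (Suc M) - 1 / 2) * of_real (real (Suc M)) powr (-s) - of_nat (Suc (Suc M)) powr (-s) / 2 +
     (of_nat (Suc (Suc M)) powr (1 - s) - of_real (real (Suc M)) powr (1 - s)) / (1 - s)) {real (Suc M)..real (Suc (Suc M))}"
    using has_integral_sawtooth_powr_step[OF s, of "real (Suc M)" "Suc M"] by (simp add: add.commute)
  from has_integral_combine[OF xM _ step(3) this]
  show ?case unfolding set
    by (simp add: diff_divide_distrib algebra_simps del: of_nat_Suc)
qed

text \<open>For fixed \<open>r < 1\<close> the Fourier series has a geometric majorant and can be
  integrated term by term. Each term is bounded with frequency \<open>2 * pi * (k + 1)\<close>, and
  the bounds sum to the cotangent expression independently of \<open>r\<close>.\<close>

lemma abel_sawtooth_integral_bound: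
  fixes s :: complex and r x y :: real
  assumes "0 < Re s" "Im s \<noteq> 0" "0 < x" "x \<le> y" "\<bar>Im s\<bar> < 2 * pi * x" "0 \<le> r" "r < 1"
  shows "norm (integral {x..y} (\<lambda>u. of_real (abel_sawtooth r u) * of_real u powr (-s-1))) \<le>
    x powr (-Re s) * (2 * x / (Im s)\<^sup>2 * (1 - Im s / (2 * x) * cot (Im s / (2 * x))))"
proof -
  define t \<theta> where "t = Im s" and "\<theta> = t / (2 * x)"
  define h where "h = (\<lambda>u::real. complex_of_real u powr (-s-1))"
  \<comment> \<open>The terms of the cotangent expansion at \<theta>; dividing \<open>t\<close> by
    \<open>2 * x\<close> turns the denominators of the oscillatory bounds into these up to the
    factor \<open>(2 * x)\<^sup>2\<close>.\<close>
  define T where "T = (\<lambda>k. 2 * \<theta>\<^sup>2 / ((pi * real (Suc k))\<^sup>2 - \<theta>\<^sup>2))"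
  have \<theta>: "\<bar>\<theta>\<bar> < pi" "\<theta> \<noteq> 0" using assms by (auto simp: \<theta>_def t_def field_simps)
  have T_sums: "T sums (1 - \<theta> * cot \<theta>)"
    unfolding T_def by (rule cot_partial_fractions[OF \<theta>])
  have ck: "\<bar>t\<bar> < 2 * pi * real (Suc k) * x" for k
  proof -
    have "2 * pi * x * 1 \<le> 2 * pi * x * real (Suc k)"
      using assms by (intro mult_left_mono) auto
    also have "\<dots> = 2 * pi * real (Suc k) * x" by (simp only: mult_ac)
    finally show ?thesis using assms(5) unfolding t_def mult_1_right by (rule order.strict_trans2[rotated])
  qed
  have cpos: "(2 * pi * real (Suc k) * x)\<^sup>2 - t\<^sup>2 > 0" for k
    using ck[of k] power_strict_mono[of "\<bar>t\<bar>" "2 * pi * real (Suc k) * x" 2] by (simp del: of_nat_Suc)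
  have T_eq: "T k = 2 * t\<^sup>2 / ((2 * pi * real (Suc k) * x)\<^sup>2 - t\<^sup>2)" for k
  proof -
    have "(pi * real (Suc k))\<^sup>2 - \<theta>\<^sup>2 = ((2 * pi * real (Suc k) * x)\<^sup>2 - t\<^sup>2) / (2 * x)\<^sup>2"
      using assms by (simp add: \<theta>_def power_divide diff_divide_distrib power_mult_distrib del: of_nat_Suc)
    moreover have "2 * \<theta>\<^sup>2 = 2 * t\<^sup>2 / (2 * x)\<^sup>2" by (simp add: \<theta>_def power_divide)
    moreover have "a / c / (b / c) = a / b" if "c \<noteq> 0" for a b c :: real using that by simp
    ultimately show ?thesis using assms(3) unfolding T_def by (simp only:) simp
  qed
  have T_nonneg: "T k \<ge> 0" for k unfolding T_eq using cpos[of k] by simp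
  define P where "P = (\<lambda>k J. ((\<lambda>u. of_real (sin (2 * pi * real (Suc k) * u)) * h u) has_integral J) {x..y} \<and>
     norm J \<le> x powr (-Re s) * (2 * (2 * pi * real (Suc k)) * x / ((2 * pi * real (Suc k) * x)\<^sup>2 - t\<^sup>2)))"
  have "\<exists>J. P k J" for k
    unfolding P_def h_def t_def by (rule has_integral_sin_powr[OF assms(3,4) ck[of k, unfolded t_def] assms(1)]) blast
  then obtain I where "\<And>k. P k (I k)" by metis
  hence I: "((\<lambda>u. of_real (sin (2 * pi * real (Suc k) * u)) * h u) has_integral I k) {x..y}"
    "norm (I k) \<le> x powr (-Re s) * (2 * (2 * pi * real (Suc k)) * x / ((2 * pi * real (Suc k) * x)\<^sup>2 - t\<^sup>2))" for k
    unfolding P_def by blast+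
  \<comment> \<open>Of the two upper bounds for these coefficients,
    \<open>1 / (pi * (k + 1))\<close> gives the estimate uniform in \<open>r\<close>, and
    \<open>r ^ k\<close> gives the majorant for dominated convergence.\<close>
  define a where "a = (\<lambda>k. r ^ Suc k / (pi * real (Suc k)))"
  have a: "0 \<le> a k" "a k \<le> 1 / (pi * real (Suc k))" "a k \<le> r ^ k" for k
  proof -
    show "0 \<le> a k" using assms by (simp add: a_def)
    show "a k \<le> 1 / (pi * real (Suc k))"
      unfolding a_def using assms by (intro divide_right_mono power_le_one) auto
    have "1 * 1 \<le> pi * real (Suc k)" using pi_gt3 by (intro mult_mono) auto
    hence "a k \<le> r ^ Suc k / 1" unfolding a_def using assms by (intro divide_left_mono) auto
    hence "a k \<le> r ^ Suc k" by simp
    also have "\<dots> \<le> r ^ k" using assms by (intro power_decreasing) auto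
    finally show "a k \<le> r ^ k" .
  qed
  define f where "f = (\<lambda>n u. \<Sum>k<n. - of_real (a k) * (of_real (sin (2 * pi * real (Suc k) * u)) * h u))"
  have f_int: "(f n has_integral (\<Sum>k<n. - of_real (a k) * I k)) {x..y}" for n
    unfolding f_def by (intro has_integral_sum has_integral_mult_right I(1)) auto
  have cont_h: "continuous_on {x..y} h"
    unfolding h_def using assms by (intro continuous_intros) (auto simp: complex_nonpos_Reals_iff)
  have lim: "(\<lambda>n. integral {x..y} (f n)) \<longlonglongrightarrow> integral {x..y} (\<lambda>u. of_real (abel_sawtooth r u) * h u)"
  proof (rule dominated_convergence(2)[where h = "\<lambda>u. 1 / (1 - r) * norm (h u)"])
    show "f n integrable_on {x..y}" for n using f_int by blast
    show "(\<lambda>u. 1 / (1 - r) * norm (h u)) integrable_on {x..y}"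
      by (intro integrable_continuous_real continuous_intros cont_h)
    show "norm (f n u) \<le> 1 / (1 - r) * norm (h u)" for n u
    proof -
      have "norm (f n u) \<le> (\<Sum>k<n. r ^ k * norm (h u))"
        unfolding f_def
      proof (rule sum_norm_le)
        fix k
        have "a k * \<bar>sin (2 * pi * real (Suc k) * u)\<bar> \<le> r ^ k * 1"
          using a(1,3)[of k] assms by (intro mult_mono) auto
        thus "norm (- of_real (a k) * (of_real (sin (2 * pi * real (Suc k) * u)) * h u)) \<le> r ^ k * norm (h u)"
          using a(1)[of k] by (simp add: norm_mult mult_right_mono flip: mult.assoc del: of_nat_Suc)
      qed
      also have "\<dots> = (\<Sum>k<n. r ^ k) * norm (h u)" by (simp add: sum_distrib_right)
      also have "\<dots> \<le> 1 / (1 - r) * norm (h u)"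
        using assms sum_le_suminf[of "\<lambda>k. r ^ k" "{..<n}"]
        by (intro mult_right_mono) (auto simp: suminf_geometric summable_geometric)
      finally show ?thesis .
    qed
    show "(\<lambda>n. f n u) \<longlonglongrightarrow> of_real (abel_sawtooth r u) * h u" for u
      using sums_mult2[OF sums_of_real[OF abel_sawtooth_sums[OF assms(6,7), of u]], of "h u"]
      unfolding sums_def f_def a_def by (simp add: mult.assoc)
  qed
  have "norm (integral {x..y} (f n)) \<le> x powr (-Re s) * (2 * x / t\<^sup>2 * (1 - \<theta> * cot \<theta>))" for n
  proof -
    have "norm (integral {x..y} (f n)) \<le> (\<Sum>k<n. x powr (-Re s) * (2 * x / t\<^sup>2) * T k)"
      unfolding integral_unique[OF f_int]
    proof (rule sum_norm_le)
      fix k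
      have "norm (- of_real (a k) * I k) = a k * norm (I k)" using a(1)[of k] by (simp add: norm_mult)
      also have "\<dots> \<le> 1 / (pi * real (Suc k)) *
         (x powr (-Re s) * (2 * (2 * pi * real (Suc k)) * x / ((2 * pi * real (Suc k) * x)\<^sup>2 - t\<^sup>2)))"
        using a(1,2)[of k] I(2)[of k] by (intro mult_mono) auto
      \<comment> \<open>The coefficient \<open>1 / (pi * (k + 1))\<close> cancels the frequency in
        the numerator, leaving a multiple of \<open>T k\<close>.\<close>
      also have "\<dots> = x powr (-Re s) * (4 * x / ((2 * pi * real (Suc k) * x)\<^sup>2 - t\<^sup>2))"
        by (simp del: of_nat_Suc)
      also have "\<dots> = x powr (-Re s) * (2 * x / t\<^sup>2) * T k"
        unfolding T_eq using assms(2) by (simp add: t_def del: of_nat_Suc)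
      finally show "norm (- of_real (a k) * I k) \<le> x powr (-Re s) * (2 * x / t\<^sup>2) * T k" .
    qed
    also have "\<dots> = x powr (-Re s) * (2 * x / t\<^sup>2) * (\<Sum>k<n. T k)" by (simp add: sum_distrib_left)
    also have "\<dots> \<le> x powr (-Re s) * (2 * x / t\<^sup>2) * (1 - \<theta> * cot \<theta>)"
      using sum_le_suminf[of T "{..<n}"] T_sums T_nonneg assms(3)
      by (intro mult_left_mono) (auto simp: sums_iff)
    finally show ?thesis by (simp only: mult.assoc)
  qed
  with tendsto_norm[OF lim] show ?thesis
    unfolding h_def t_def \<theta>_def by (intro LIMSEQ_le_const2) blast+
qed

text \<open>The Abel bound is free of \<open>r\<close>, so it passes to the limit along
  \<open>r = j / (j + 1)\<close>. Dominated convergence applies because the means are bounded by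
  1/2.\<close>

lemma sawtooth_integral_bound:
  fixes s :: complex and x y :: real
  assumes "0 < Re s" "Im s \<noteq> 0" "0 < x" "x \<le> y" "\<bar>Im s\<bar> < 2 * pi * x"
  shows "norm (integral {x..y} (\<lambda>u. of_real (sawtooth u) * of_real u powr (-s-1))) \<le>
    x powr (-Re s) * (2 * x / (Im s)\<^sup>2 * (1 - Im s / (2 * x) * cot (Im s / (2 * x))))"
proof -
  define h where "h = (\<lambda>u::real. complex_of_real u powr (-s-1))"
  have cont_h: "continuous_on {x..y} h"
    unfolding h_def using assms by (intro continuous_intros) (auto simp: complex_nonpos_Reals_iff)
  define r where "r = (\<lambda>j. real j / real (Suc j))"
  have r: "0 \<le> r j" "r j < 1" for j by (auto simp: r_def)
  have "r \<longlonglongrightarrow> 1" unfolding r_def by (rule LIMSEQ_n_over_Suc_n)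
  note r_lim = abel_sawtooth_tendsto[OF r this]
  have "(\<lambda>j. integral {x..y} (\<lambda>u. of_real (abel_sawtooth (r j) u) * h u)) \<longlonglongrightarrow>
      integral {x..y} (\<lambda>u. of_real (sawtooth u) * h u)"
  proof (rule dominated_convergence(2)[where h = "\<lambda>u. 1 / 2 * norm (h u)"])
    show "(\<lambda>u. of_real (abel_sawtooth (r j) u) * h u) integrable_on {x..y}" for j
      by (intro integrable_continuous_real continuous_intros cont_h continuous_on_abel_sawtooth r)
    show "(\<lambda>u. 1 / 2 * norm (h u)) integrable_on {x..y}"
      by (intro integrable_continuous_real continuous_intros cont_h)
    show "norm (of_real (abel_sawtooth (r j) u) * h u) \<le> 1 / 2 * norm (h u)" for j u
      unfolding norm_mult norm_of_real by (intro mult_right_mono abel_sawtooth_bound r norm_ge_zero)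
    show "(\<lambda>j. of_real (abel_sawtooth (r j) u) * h u) \<longlonglongrightarrow> of_real (sawtooth u) * h u" for u
      by (intro tendsto_intros r_lim)
  qed
  from tendsto_norm[OF this] abel_sawtooth_integral_bound[OF assms r] show ?thesis
    unfolding h_def by (intro LIMSEQ_le_const2) blast+
qed

text \<open>Euler-Maclaurin summation, with the improper integral expressed as a limit of integrals
  up to integers. The sum over \<open>n > x\<close> is rewritten as a difference of partial sums,
  whose corrected limit is zeta.\<close>

lemma zeta_remainder_LIMSEQ:
  fixes s :: complex and x :: real
  assumes "0 < Re s" "s \<noteq> 1" "1 \<le> x"
  shows "(\<lambda>M. s * integral {x..real (Suc M)} (\<lambda>u. of_real (sawtooth u) * of_real u powr (-s-1)))
    \<longlonglongrightarrow> of_real (frac x - 1 / 2) * of_real x powr (-s) - zeta_remainder s x"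
proof -
  define N where "N = nat \<lfloor>x\<rfloor>"
  define S where "S = (\<lambda>M. \<Sum>n\<in>{1..M}. of_nat n powr (-s))"
  define p where "p = (\<lambda>M. of_nat (Suc M) powr (-s))"
  have "{n::nat. 1 \<le> n \<and> real n \<le> x} = {1..N}"
    using assms(3) by (auto simp: N_def le_nat_floor) linarith
  hence R: "zeta_remainder s x = riemann_zeta s - (S N - of_real x powr (1 - s) / (1 - s))"
    by (simp add: zeta_remainder_def S_def)
  have "(\<lambda>M. of_real (frac x - 1 / 2) * of_real x powr (-s) + S N - of_real x powr (1 - s) / (1 - s)
      - (S M - of_nat (Suc M) powr (1 - s) / (1 - s)) - p M / 2) \<longlonglongrightarrow>
      of_real (frac x - 1 / 2) * of_real x powr (-s) + S N - of_real x powr (1 - s) / (1 - s) - riemann_zeta s - 0 / 2"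
    unfolding S_def p_def by (intro tendsto_intros riemann_zeta_LIMSEQ of_nat_powr_tendsto_0) (use assms in auto)
  also have "of_real (frac x - 1 / 2) * of_real x powr (-s) + S N - of_real x powr (1 - s) / (1 - s) - riemann_zeta s - 0 / 2
     = of_real (frac x - 1 / 2) * of_real x powr (-s) - zeta_remainder s x"
    by (simp add: R)
  finally show ?thesis
  proof (rule Lim_transform_eventually)
    show "\<forall>\<^sub>F M in sequentially. of_real (frac x - 1 / 2) * of_real x powr (-s) + S N - of_real x powr (1 - s) / (1 - s)
      - (S M - of_nat (Suc M) powr (1 - s) / (1 - s)) - p M / 2 =
      s * integral {x..real (Suc M)} (\<lambda>u. of_real (sawtooth u) * of_real u powr (-s-1))"
      using eventually_ge_at_top[of N]
    proof eventually_elim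
      case (elim M)
      have "{1..Suc M} = {1..N} \<union> {N<..Suc M}" using elim by auto
      hence "S (Suc M) = S N + (\<Sum>n\<in>{N<..Suc M}. of_nat n powr (-s))"
        unfolding S_def by (simp only:) (rule sum.union_disjoint, auto)
      moreover have "S (Suc M) = S M + p M" by (simp add: S_def p_def)
      \<comment> \<open>The last term is split into halves so that one of them cancels the endpoint
        correction \<open>p M / 2\<close> of the integral formula.\<close>
      ultimately have *: "(\<Sum>n\<in>{N<..Suc M}. of_nat n powr (-s)) = S M + (p M / 2 + p M / 2) - S N"
        by (simp add: algebra_simps)
      have "s * integral {x..real (Suc M)} (\<lambda>u. of_real (sawtooth u) * of_real u powr (-s-1)) =
        of_real (frac x - 1 / 2) * of_real x powr (-s) - (S M + (p M / 2 + p M / 2) - S N) + p M / 2 +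
        (of_nat (Suc M) powr (1 - s) - of_real x powr (1 - s)) / (1 - s)"
        using integral_unique[OF has_integral_sawtooth_powr[OF assms(2,3) elim[unfolded N_def]]]
        unfolding N_def[symmetric] * by (simp add: p_def del: of_nat_Suc)
      thus ?case by (simp only: diff_divide_distrib) (simp only: algebra_simps)
    qed
  qed
qed

section \<open>Assembling the estimate from the boundary term and the integral\<close>

theorem theorem5:
  fixes s :: complex and \<sigma> t x :: real
  assumes "s = of_real \<sigma> + \<i> * of_real t"
    and "0 < \<sigma>" and "\<sigma> \<le> 1" and "s \<noteq> 1" and "t \<noteq> 0"
    and "x \<ge> 1" and "\<bar>t\<bar> < 2 * pi * x"
  shows "norm (zeta_remainder s x) \<le>
    x powr (-\<sigma>) * (1 / 2 + 3 * x / \<bar>t\<bar> * sqrt (1 + (\<sigma> / t)\<^sup>2) *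
      (1 - t / (2 * x) * cot (t / (2 * x))))"
proof -
  define Q where "Q = 1 - t / (2 * x) * cot (t / (2 * x))"
  define V where "V = of_real (frac x - 1 / 2) * of_real x powr (-s) - zeta_remainder s x"
  have s: "Re s = \<sigma>" "Im s = t" using assms(1) by auto
  \<comment> \<open>The bound does not depend on the upper limit of integration, so it carries over
    to the limit \<open>V\<close>.\<close>
  have ev: "\<forall>\<^sub>F M in sequentially. norm (s * integral {x..real (Suc M)} (\<lambda>u. of_real (sawtooth u) * of_real u powr (-s-1)))
      \<le> norm s * (x powr (-\<sigma>) * (2 * x / t\<^sup>2 * Q))"
    using eventually_ge_at_top[of "nat \<lceil>x\<rceil>"]
  proof eventually_elim
    case (elim M)
    hence "x \<le> real (Suc M)" by linarith
    thus ?case unfolding norm_mult Q_def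
      using sawtooth_integral_bound[of s x "real (Suc M)"] assms by (intro mult_left_mono) (simp_all add: s)
  qed
  have "(\<lambda>M. norm (s * integral {x..real (Suc M)} (\<lambda>u. of_real (sawtooth u) * of_real u powr (-s-1)))) \<longlonglongrightarrow> norm V"
    unfolding V_def using assms by (intro tendsto_norm zeta_remainder_LIMSEQ) (auto simp: s)
  from tendsto_upperbound[OF this ev]
  have V: "norm V \<le> norm s * (x powr (-\<sigma>) * (2 * x / t\<^sup>2 * Q))" by simp
  \<comment> \<open>This is the source of the square root: \<open>norm s / t\<^sup>2\<close>
    contributes it together with \<open>1 / \<bar>t\<bar>\<close>.\<close>
  have ns: "norm s = \<bar>t\<bar> * sqrt (1 + (\<sigma> / t)\<^sup>2)"
  proof -
    have "\<sigma>\<^sup>2 + t\<^sup>2 = t\<^sup>2 * (1 + (\<sigma> / t)\<^sup>2)" using assms(5) by (simp add: field_simps)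
    thus ?thesis by (simp add: cmod_def s real_sqrt_mult)
  qed
  \<comment> \<open>All terms of the partial fraction series are nonnegative because
    \<open>\<bar>t / (2 * x)\<bar> < pi\<close>.\<close>
  have Q: "Q \<ge> 0"
  proof -
    have \<theta>: "\<bar>t / (2 * x)\<bar> < pi" "t / (2 * x) \<noteq> 0" using assms by (auto simp: field_simps)
    have "(t / (2 * x))\<^sup>2 \<le> (pi * real (Suc k))\<^sup>2" for k
    proof -
      have "pi * 1 \<le> pi * real (Suc k)" by (intro mult_left_mono) auto
      thus ?thesis using \<theta>(1) by (intro power2_le_iff_abs_le[THEN iffD2]) linarith+
    qed
    thus ?thesis unfolding Q_def
      by (intro sums_le[OF _ sums_zero cot_partial_fractions[OF \<theta>]]) (simp del: of_nat_Suc)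
  qed
  have "zeta_remainder s x = of_real (frac x - 1 / 2) * of_real x powr (-s) - V" by (simp add: V_def)
  hence "norm (zeta_remainder s x) \<le> norm (of_real (frac x - 1 / 2) * of_real x powr (-s)) + norm V"
    using norm_triangle_ineq4 by metis
  also have "norm (of_real (frac x - 1 / 2) * of_real x powr (-s)) \<le> 1 / 2 * x powr (-\<sigma>)"
  proof -
    have "\<bar>frac x - 1 / 2\<bar> \<le> 1 / 2" using frac_ge_0[of x] frac_lt_1[of x] by linarith
    moreover have "norm (of_real x powr (-s)) = x powr (-\<sigma>)" using assms(6) s by (simp add: norm_powr_real_powr)
    ultimately show ?thesis unfolding norm_mult norm_of_real by (metis mult_right_mono powr_ge_zero)
  qed
  also note V
  also have "norm s * (x powr (-\<sigma>) * (2 * x / t\<^sup>2 * Q)) = x powr (-\<sigma>) * (2 * x / \<bar>t\<bar> * sqrt (1 + (\<sigma> / t)\<^sup>2) * Q)"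
  proof -
    have "\<bar>t\<bar> * (2 * x / t\<^sup>2) = 2 * x / \<bar>t\<bar>" using assms(5) by (simp add: field_simps power2_eq_square abs_if)
    hence "norm s * (2 * x / t\<^sup>2) = 2 * x / \<bar>t\<bar> * sqrt (1 + (\<sigma> / t)\<^sup>2)"
      unfolding ns by (metis mult.assoc mult.commute)
    thus ?thesis by (metis mult.assoc mult.left_commute)
  qed
  \<comment> \<open>The constant obtained is 2; enlarging it to the stated 3 is legitimate because
    \<open>Q\<close> is nonnegative.\<close>
  also have "\<dots> \<le> x powr (-\<sigma>) * (3 * x / \<bar>t\<bar> * sqrt (1 + (\<sigma> / t)\<^sup>2) * Q)"
    using assms(6) Q by (intro mult_left_mono mult_right_mono divide_right_mono) auto
  finally show ?thesis unfolding Q_def by (simp add: algebra_simps)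
qed

end
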